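(* Let $(\alpha,\mu,P)$ be a network without overflows with $n$ nodes. Then $(\alpha,\mu,P)$ is NI (contains no isolated class) if and only if the traffic equation $\lambda=\alpha+\min(\lambda,\mu)P$ has a unique, nonnegative solution. Additionally, if $(\alpha,\mu,P)$ is NI, then the Goodman--Massey algorithm (described in the context) finds this solution in at most $n$ iterations. Each iteration consists of solving a linear equation in $n$ variables that has a unique solution.
   Context: Vectors are row vectors; inequalities and $\min$ are entrywise. Let $n\in\mathbb{N}$ and $N=\{1,\dots,n\}$. A network without overflows $(\alpha,\mu,P)$ consists of a vector $\alpha\in\mathbb{R}^n$ with $\alpha\ge 0$, a vector $\mu\in\mathbb{R}^n$ with $\mu>0$ (all entries strictly positive), and a substochastic $n\times n$ matrix $P=(p_{ij})$ (nonnegative entries, row sums at most $1$). Write $p_{ij}^k$ for the $(i,j)$ entry of the matrix power $P^k$. The unknown in the traffic equation is $\lambda\in\mathbb{R}^n$. Communicating classes: $i,j\in N$ communicate if $i=j$ or if $p_{ij}^k>0$ and $p_{ji}^l>0$ for some $k,l\ge 0$; the equivalence classes are called the classes of $P$. A class $C$ can be filled if $\alpha_i>0$ for some $i\in C$, or if there are $i\in N$ with $\alpha_i>0$, $j\in C$ and $k\in\mathbb{N}$ with $p_{ij}^k>0$. A class $C$ can be drained if there is $i\in C$ with $\sum_{j=1}^n p_{ij}<1$ (externally drained), or there are $i\in C$ and $j\in N\setminus C$ with $p_{ij}>0$ (internally drained). A class is isolated if it can be neither filled nor drained. The network $(\alpha,\mu,P)$ is NI if it contains no isolated class. For $A\subset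 N$, $P_A$ denotes the $n\times n$ matrix obtained from $P$ by replacing all rows with index not in $A$ by zero rows. Goodman--Massey algorithm: set $S^{(0)}=\emptyset$. For $\kappa=1,2,\dots$: solve the linear equation $\lambda=\alpha+\mu P_{N\setminus S}+\lambda P_S$ with $S=S^{(\kappa-1)}$ to obtain a solution denoted by $\lambda^{(\kappa)}$, and set $S^{(\kappa)}=\{i\in N:\lambda_i^{(\kappa)}<\mu_i\}$. Stop at the first $\kappa\ge 1$ with $S^{(\kappa)}=S^{(\kappa-1)}$ and return $\lambda^{(\kappa)}$.
   Formalization: The bound of n iterations fails (n=1, α=0.1, μ=1, P=0.5 needs 2 under the stated stopping rule); it is proved as at most n iterations if the final set S is not all of N, and at most n+1 if it is. *)

theory Defs
  imports "HOL-Analysis.Analysis"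
begin

text \<open>
  Nodes are the elements of a finite type \<open>'n\<close>, so the number of nodes is \<open>CARD('n)\<close>.
  Vectors are row vectors; \<open>x v* P\<close> is the library's product of a row vector with a matrix.
\<close>

definition substochastic :: "real ^ 'n ^ 'n \<Rightarrow> bool" where
  "substochastic P \<longleftrightarrow> (\<forall>i j. 0 \<le> P $ i $ j) \<and> (\<forall>i. (\<Sum>j\<in>UNIV. P $ i $ j) \<le> 1)"

definition network :: "real ^ 'n \<Rightarrow> real ^ 'n \<Rightarrow> real ^ 'n ^ 'n \<Rightarrow> bool" where
  "network \<alpha> \<mu> P \<longleftrightarrow> (\<forall>i. 0 \<le> \<alpha> $ i) \<and> (\<forall>i. 0 < \<mu> $ i) \<and> substochastic P"

text \<open>Not written with \<open>^\<close>, since the library's multiplication on vectors is componentwise.\<close>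

primrec matpow :: "real ^ 'n ^ 'n \<Rightarrow> nat \<Rightarrow> real ^ 'n ^ 'n" where
  "matpow P 0 = mat 1"
| "matpow P (Suc k) = P ** matpow P k"

definition communicate :: "real ^ 'n ^ 'n \<Rightarrow> 'n \<Rightarrow> 'n \<Rightarrow> bool" where
  "communicate P i j \<longleftrightarrow>
     i = j \<or> (\<exists>k l. 0 < matpow P k $ i $ j \<and> 0 < matpow P l $ j $ i)"

definition classes :: "real ^ 'n ^ 'n \<Rightarrow> 'n set set" where
  "classes P = UNIV // {(i, j). communicate P i j}"

definition can_be_filled :: "real ^ 'n \<Rightarrow> real ^ 'n ^ 'n \<Rightarrow> 'n set \<Rightarrow> bool" where
  "can_be_filled \<alpha> P C \<longleftrightarrow>
     (\<exists>i\<in>C. 0 < \<alpha> $ i) \<or> (\<exists>i. \<exists>j\<in>C. \<exists>k. 0 < \<alpha> $ i \<and> 0 < matpow P k $ i $ j)"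

definition externally_drained :: "real ^ 'n ^ 'n \<Rightarrow> 'n set \<Rightarrow> bool" where
  "externally_drained P C \<longleftrightarrow> (\<exists>i\<in>C. (\<Sum>j\<in>UNIV. P $ i $ j) < 1)"

definition internally_drained :: "real ^ 'n ^ 'n \<Rightarrow> 'n set \<Rightarrow> bool" where
  "internally_drained P C \<longleftrightarrow> (\<exists>i\<in>C. \<exists>j\<in>-C. 0 < P $ i $ j)"

definition can_be_drained :: "real ^ 'n ^ 'n \<Rightarrow> 'n set \<Rightarrow> bool" where
  "can_be_drained P C \<longleftrightarrow> externally_drained P C \<or> internally_drained P C"

definition isolated_class :: "real ^ 'n \<Rightarrow> real ^ 'n ^ 'n \<Rightarrow> 'n set \<Rightarrow> bool" where
  "isolated_class \<alpha> P C \<longleftrightarrow>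
     C \<in> classes P \<and> \<not> can_be_filled \<alpha> P C \<and> \<not> can_be_drained P C"

text \<open>
  The vector \<open>\<mu>\<close> does not occur in the definition of isolated classes, so it is not an
  argument of \<open>NI\<close>.
\<close>

definition NI :: "real ^ 'n \<Rightarrow> real ^ 'n ^ 'n \<Rightarrow> bool" where
  "NI \<alpha> P \<longleftrightarrow> \<not> (\<exists>C. isolated_class \<alpha> P C)"

definition vmin :: "real ^ 'n \<Rightarrow> real ^ 'n \<Rightarrow> real ^ 'n" where
  "vmin x y = (\<chi> i. min (x $ i) (y $ i))"

definition traffic_solution ::
    "real ^ 'n \<Rightarrow> real ^ 'n \<Rightarrow> real ^ 'n ^ 'n \<Rightarrow> real ^ 'n \<Rightarrow> bool" where
  "traffic_solution \<alpha> \<mu> P x \<longleftrightarrow> x = \<alpha> + vmin x \<mu> v* P"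

definition restrict_rows :: "real ^ 'n ^ 'n \<Rightarrow> 'n set \<Rightarrow> real ^ 'n ^ 'n" where
  "restrict_rows P A = (\<chi> i j. if i \<in> A then P $ i $ j else 0)"

definition gm_equation ::
    "real ^ 'n \<Rightarrow> real ^ 'n \<Rightarrow> real ^ 'n ^ 'n \<Rightarrow> 'n set \<Rightarrow> real ^ 'n \<Rightarrow> bool" where
  "gm_equation \<alpha> \<mu> P S x \<longleftrightarrow>
     x = \<alpha> + \<mu> v* restrict_rows P (-S) + x v* restrict_rows P S"

text \<open>
  The Goodman--Massey algorithm. The choice operator picks a solution of the linear
  equation; it is meaningful only when the equation is solvable, which is a matter to be
  proved. Iterations are numbered from 1: iteration \<open>\<kappa>\<close> computes \<open>gm_lambda \<alpha> \<mu> P \<kappa>\<close> from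
  \<open>gm_set \<alpha> \<mu> P (\<kappa> - 1)\<close>, and the value of \<open>gm_lambda\<close> at 0 is irrelevant.
\<close>

definition gm_solve ::
    "real ^ 'n \<Rightarrow> real ^ 'n \<Rightarrow> real ^ 'n ^ 'n \<Rightarrow> 'n set \<Rightarrow> real ^ 'n" where
  "gm_solve \<alpha> \<mu> P S = (SOME x. gm_equation \<alpha> \<mu> P S x)"

primrec gm_set :: "real ^ 'n \<Rightarrow> real ^ 'n \<Rightarrow> real ^ 'n ^ 'n \<Rightarrow> nat \<Rightarrow> 'n set" where
  "gm_set \<alpha> \<mu> P 0 = {}"
| "gm_set \<alpha> \<mu> P (Suc \<kappa>) = {i. gm_solve \<alpha> \<mu> P (gm_set \<alpha> \<mu> P \<kappa>) $ i < \<mu> $ i}"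

definition gm_lambda ::
    "real ^ 'n \<Rightarrow> real ^ 'n \<Rightarrow> real ^ 'n ^ 'n \<Rightarrow> nat \<Rightarrow> real ^ 'n" where
  "gm_lambda \<alpha> \<mu> P \<kappa> = gm_solve \<alpha> \<mu> P (gm_set \<alpha> \<mu> P (\<kappa> - 1))"

definition gm_stops_at :: "real ^ 'n \<Rightarrow> real ^ 'n \<Rightarrow> real ^ 'n ^ 'n \<Rightarrow> nat \<Rightarrow> bool" where
  "gm_stops_at \<alpha> \<mu> P \<kappa> \<longleftrightarrow>
     1 \<le> \<kappa> \<and> gm_set \<alpha> \<mu> P \<kappa> = gm_set \<alpha> \<mu> P (\<kappa> - 1) \<and>
     (\<forall>\<kappa>'\<in>{1..<\<kappa>}. gm_set \<alpha> \<mu> P \<kappa>' \<noteq> gm_set \<alpha> \<mu> P (\<kappa>' - 1))"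

text \<open>
  A pitfall in counting iterations: the sets \<open>gm_set \<alpha> \<mu> P \<kappa>\<close> are increasing, and the
  last iteration is the one that leaves the set unchanged. If the final set is not the set
  of all nodes, this gives at most \<open>CARD('n)\<close> iterations. If the final set is the set of all
  nodes, \<open>CARD('n) + 1\<close> iterations may be needed: for one node with \<open>\<alpha> = 1/10\<close>, \<open>\<mu> = 1\<close>,
  \<open>P = 1/2\<close>, iteration 1 gives \<open>\<lambda> = 6/10\<close>, which changes the set from \<open>{}\<close> to \<open>UNIV\<close> and is
  not the solution; iteration 2 gives the solution \<open>\<lambda> = 2/10\<close>.
\<close>

end

theory Submission
  imports Defs
begin

text \<open>
  Everything rests on conservation of mass. If \<open>v\<close> is a vector of departure rates, the total
  inflow that \<open>v v* P\<close> delivers to a set \<open>D\<close> of nodes is \<open>\<Sum>i. v $ i * p\<^sub>D i\<close> with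
  \<open>p\<^sub>D i = (\<Sum>j\<in>D. P $ i $ j) \<le> 1\<close>, so a node of \<open>D\<close> cannot return more to \<open>D\<close> than it
  sends out. Apply this to the set where two vectors are in the wrong order: the slacks in
  the comparison are nonnegative and sum to zero, hence all vanish
  (\<open>flow_balance\<close>), and the set must be absorbing, i.e. its nodes send all their
  output back into it. The proofs of solvability and of uniqueness both end with an absorbing set
  that contradicts a hypothesis.

  Solvability and the algorithm. The matrix \<open>I - P\<^sub>S\<close> has a nonnegative inverse as soon as
  \<open>S\<close> contains no absorbing set (\<open>comparison_principle\<close>, \<open>gm_equation_ex1\<close>). This
  property is inherited from one iterate to the next: in an absorbing set \<open>D\<close> of nodes
  with \<open>\<lambda> < \<mu>\<close>, the arrivals are at least what the nodes of \<open>D\<close> send out, which forces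
  \<open>D\<close> into the previous iterate. The comparison principle also shows that the
  \<open>\<lambda>\<close>s decrease, so the sets increase (\<open>gm_set_invariant\<close>); they must therefore stop
  growing, and the vector found then is a nonnegative solution of the traffic equation.
  Both directions of the equivalence start from this solution.

  Uniqueness. An absorbing set contains an absorbing communicating class, so the network
  is NI iff every absorbing set can be filled (\<open>NI_iff_absorbing_filled\<close>). If two
  solutions differ, the set where one exceeds the other is absorbing and both are at most
  \<open>\<mu>\<close> there. For the nonnegative one of the two, such a set receives nothing
  (\<open>absorbing_le_not_filled\<close>), against NI. Conversely, an absorbing set that cannot be filled
  is decoupled from the rest in every nonnegative solution. So the solution can be replaced
  there by zero, or by a small multiple of an invariant vector of \<open>P\<close> on that set, and this
  gives two solutions (\<open>traffic_solution_not_unique\<close>).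
\<close>

section \<open>Conservation of mass\<close>

lemma vector_matrix_mult_nth: "(v v* P) $ j = (\<Sum>i\<in>UNIV. v $ i * P $ i $ j)"
  for v :: "real ^ 'm"
  by (simp add: vector_matrix_mult_def mult.commute)

lemma sum_vector_matrix_mult:
  fixes v :: "real ^ 'm"
  shows "(\<Sum>j\<in>D. (v v* P) $ j) = (\<Sum>i\<in>UNIV. v $ i * (\<Sum>j\<in>D. P $ i $ j))"
  unfolding vector_matrix_mult_nth sum_distrib_left by (rule sum.swap)

lemma substochastic_row_le_1:
  assumes "substochastic P"
  shows "(\<Sum>j\<in>D. P $ i $ j) \<le> 1"
proof -
  have "(\<Sum>j\<in>D. P $ i $ j) \<le> (\<Sum>j\<in>UNIV. P $ i $ j)"
    using assms by (intro sum_mono2) (auto simp: substochastic_def)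
  then show ?thesis
    using assms order_trans by (fastforce simp: substochastic_def)
qed

lemma substochastic_row_nonneg:
  "substochastic P \<Longrightarrow> 0 \<le> (\<Sum>j\<in>D. P $ i $ j)"
  by (simp add: substochastic_def sum_nonneg)

lemma mult_row_ge_self:
  assumes "substochastic P" "c \<le> 0"
  shows "c \<le> c * (\<Sum>j\<in>D. P $ i $ j)"
  using mult_left_mono_neg[OF substochastic_row_le_1[OF assms(1)] assms(2), of i D] by simp

text \<open>
  Summing over \<open>D\<close> gives
  \<open>\<Sum>D d \<ge> \<Sum>D (v v* P) = \<Sum>i\<in>D. v\<^sub>i p\<^sub>D i + \<Sum>i\<notin>D. v\<^sub>i p\<^sub>D i \<ge> \<Sum>D v \<ge> \<Sum>D d\<close>, so all the
  inequalities assumed are equalities. For substochastic \<open>P\<close>, the hypothesis on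
  \<open>v\<^sub>i p\<^sub>D i\<close> for \<open>i \<in> D\<close> holds in two typical situations: \<open>v\<^sub>i \<le> 0\<close>, where the third
  conclusion then says \<open>p\<^sub>D i = 1\<close> if \<open>v\<^sub>i < 0\<close>, and \<open>p\<^sub>D i = 1\<close>, where \<open>v\<^sub>i\<close> may have any sign.
\<close>
lemma flow_balance:
  fixes d v :: "real ^ 'n"
  assumes bal: "\<forall>j\<in>D. (v v* P) $ j \<le> d $ j"
    and outside: "\<forall>i\<in>-D. 0 \<le> v $ i * (\<Sum>j\<in>D. P $ i $ j)"
    and kept: "\<forall>i\<in>D. v $ i \<le> v $ i * (\<Sum>j\<in>D. P $ i $ j)"
    and inside: "\<forall>i\<in>D. d $ i \<le> v $ i"
  shows "j \<in> D \<Longrightarrow> (v v* P) $ j = d $ j"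
    and "i \<notin> D \<Longrightarrow> v $ i * (\<Sum>j\<in>D. P $ i $ j) = 0"
    and "i \<in> D \<Longrightarrow> v $ i * (\<Sum>j\<in>D. P $ i $ j) = v $ i"
    and "i \<in> D \<Longrightarrow> v $ i = d $ i"
proof -
  let ?p = "\<lambda>i. v $ i * (\<Sum>j\<in>D. P $ i $ j)"
  have split: "(\<Sum>j\<in>D. (v v* P) $ j) = (\<Sum>i\<in>D. ?p i) + (\<Sum>i\<in>-D. ?p i)"
    unfolding sum_vector_matrix_mult
    by (subst sum.union_disjoint[symmetric]) (auto intro: sum.cong)
  let ?a = "\<Sum>j\<in>D. d $ j - (v v* P) $ j" and ?b = "\<Sum>i\<in>-D. ?p i"
    and ?c = "\<Sum>i\<in>D. ?p i - v $ i" and ?e = "\<Sum>i\<in>D. v $ i - d $ i"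
  have "?a + ?b + ?c + ?e = 0"
    using split by (simp add: sum_subtractf)
  moreover have "0 \<le> ?a" "0 \<le> ?b" "0 \<le> ?c" "0 \<le> ?e"
    by (use bal outside kept inside in \<open>auto intro!: sum_nonneg\<close>)
  ultimately have zero: "?a = 0" "?b = 0" "?c = 0" "?e = 0"
    by linarith+
  have term_zero: "f i = 0" if "(\<Sum>i\<in>A. f i) = 0" "\<forall>i\<in>A. 0 \<le> f i" "i \<in> A"
    for f :: "'n \<Rightarrow> real" and A i
    using that by (intro sum_nonneg_0[of A f]) auto
  show "(v v* P) $ j = d $ j" if "j \<in> D"
    using term_zero[OF zero(1) _ that] bal by simp
  show "?p i = 0" if "i \<notin> D"
    using term_zero[OF zero(2)] outside that by simp
  show "?p i = v $ i" if "i \<in> D"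
    using term_zero[OF zero(3) _ that] kept by simp
  show "v $ i = d $ i" if "i \<in> D"
    using term_zero[OF zero(4) _ that] inside by simp
qed

section \<open>Absorbing sets and isolated classes\<close>

definition absorbing :: "real ^ 'n ^ 'n \<Rightarrow> 'n set \<Rightarrow> bool" where
  "absorbing P D \<longleftrightarrow> D \<noteq> {} \<and> (\<forall>i\<in>D. (\<Sum>j\<in>D. P $ i $ j) = 1)"

lemma absorbing_iff:
  assumes "substochastic P"
  shows "absorbing P D \<longleftrightarrow>
    D \<noteq> {} \<and> (\<forall>i\<in>D. (\<Sum>j\<in>UNIV. P $ i $ j) = 1 \<and> (\<forall>j\<in>-D. P $ i $ j = 0))"
proof -
  have "(\<Sum>j\<in>D. P $ i $ j) = 1 \<longleftrightarrow>
      (\<Sum>j\<in>UNIV. P $ i $ j) = 1 \<and> (\<forall>j\<in>-D. P $ i $ j = 0)" for i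
  proof -
    have "(\<Sum>j\<in>UNIV. P $ i $ j) = (\<Sum>j\<in>D. P $ i $ j) + (\<Sum>j\<in>-D. P $ i $ j)"
      by (subst sum.union_disjoint[symmetric]) (auto intro: sum.cong)
    moreover have "(\<Sum>j\<in>-D. P $ i $ j) = 0 \<longleftrightarrow> (\<forall>j\<in>-D. P $ i $ j = 0)"
      using assms by (subst sum_nonneg_eq_0_iff) (auto simp: substochastic_def)
    ultimately show ?thesis
      using substochastic_row_le_1[OF assms, of i UNIV]
        substochastic_row_nonneg[OF assms, of i "-D"] by auto
  qed
  then show ?thesis
    by (simp add: absorbing_def)
qed

definition edges :: "real ^ 'n ^ 'n \<Rightarrow> ('n \<times> 'n) set" where
  "edges P = {(i, j). 0 < P $ i $ j}"

lemma matpow_nonneg: "substochastic P \<Longrightarrow> 0 \<le> matpow P k $ i $ j"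
  by (induction k arbitrary: i j)
    (auto simp: mat_def matrix_matrix_mult_def substochastic_def intro!: sum_nonneg)

lemma matpow_pos_iff:
  assumes "substochastic P"
  shows "0 < matpow P k $ i $ j \<longleftrightarrow> (i, j) \<in> edges P ^^ k"
proof (induction k arbitrary: i)
  case 0
  show ?case by (simp add: mat_def)
next
  case (Suc k)
  have nonneg: "0 \<le> P $ i $ l * matpow P k $ l $ j" for l
    using assms matpow_nonneg[OF assms] by (simp add: substochastic_def)
  have "0 < matpow P (Suc k) $ i $ j \<longleftrightarrow> (\<Sum>l\<in>UNIV. P $ i $ l * matpow P k $ l $ j) \<noteq> 0"
    using sum_nonneg[of UNIV "\<lambda>l. P $ i $ l * matpow P k $ l $ j"] nonneg
    by (simp add: matrix_matrix_mult_def less_le)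
  also have "\<dots> \<longleftrightarrow> (\<exists>l. P $ i $ l * matpow P k $ l $ j \<noteq> 0)"
    using nonneg by (subst sum_nonneg_eq_0_iff) auto
  also have "\<dots> \<longleftrightarrow> (\<exists>l. 0 < P $ i $ l \<and> 0 < matpow P k $ l $ j)"
    using assms matpow_nonneg[OF assms] by (auto simp: substochastic_def less_le)
  also have "\<dots> \<longleftrightarrow> (i, j) \<in> edges P O edges P ^^ k"
    by (auto simp: Suc edges_def)
  finally show ?case
    by (simp add: relpow_commute)
qed

lemma ex_matpow_pos_iff:
  "substochastic P \<Longrightarrow> (\<exists>k. 0 < matpow P k $ i $ j) \<longleftrightarrow> (i, j) \<in> (edges P)\<^sup>*"
  by (simp add: matpow_pos_iff rtrancl_power)

lemma communicate_iff:
  assumes "substochastic P"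
  shows "communicate P i j \<longleftrightarrow> (i, j) \<in> (edges P)\<^sup>* \<and> (j, i) \<in> (edges P)\<^sup>*"
  using ex_matpow_pos_iff[OF assms] by (auto simp: communicate_def)

lemma absorbing_rtrancl:
  assumes "substochastic P" "absorbing P D" "(i, j) \<in> (edges P)\<^sup>*" "i \<in> D"
  shows "j \<in> D"
  using assms(3,4)
proof (induction rule: rtrancl_induct)
  case (step j k)
  then show ?case
    using assms(2) by (force simp: absorbing_iff[OF assms(1)] edges_def)
qed

text \<open>
  A minimal absorbing subset is such a class: the set of nodes reachable from one of its
  members is again absorbing, hence is the whole subset.
\<close>
lemma absorbing_contains_class:
  assumes P: "substochastic P" and D: "absorbing P D"
  obtains C where "C \<subseteq> D" "absorbing P C" "C \<in> classes P"
proof -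
  have "absorbing P D \<and> D \<subseteq> D" using D by simp
  from ex_has_least_nat[of "\<lambda>C. absorbing P C \<and> C \<subseteq> D", OF this, of card]
  obtain C where C: "absorbing P C" "C \<subseteq> D"
    and least: "\<And>C'. absorbing P C' \<Longrightarrow> C' \<subseteq> D \<Longrightarrow> card C \<le> card C'"
    by blast
  have reach: "{j. (i, j) \<in> (edges P)\<^sup>*} = C" if "i \<in> C" for i
  proof -
    let ?T = "{j. (i, j) \<in> (edges P)\<^sup>*}"
    have sub: "?T \<subseteq> C"
      using absorbing_rtrancl[OF P C(1) _ that] by auto
    have "P $ k $ j = 0" if "k \<in> ?T" "j \<notin> ?T" for k j
    proof (rule ccontr)
      assume "P $ k $ j \<noteq> 0"
      then have "(k, j) \<in> edges P"
        using P by (auto simp: edges_def substochastic_def less_le)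
      then show False using that by (auto intro: rtrancl.rtrancl_into_rtrancl)
    qed
    then have "absorbing P ?T"
      using C(1) sub by (auto simp: absorbing_iff[OF P])
    then have "card C \<le> card ?T"
      using least sub C(2) by blast
    then show "?T = C"
      using sub by (intro card_seteq) auto
  qed
  obtain i where i: "i \<in> C"
    using C(1) by (auto simp: absorbing_def)
  have "communicate P i j \<longleftrightarrow> j \<in> C" for j
    using reach[OF i] reach[of j] i by (auto simp: communicate_iff[OF P])
  then have "C = {(i, j). communicate P i j} `` {i}"
    by auto
  then have "C \<in> classes P"
    unfolding classes_def by (metis UNIV_I quotientI)
  with C that show thesis by blast
qed

lemma absorbing_iff_not_drained:
  assumes "substochastic P"
  shows "absorbing P C \<longleftrightarrow> C \<noteq> {} \<and> \<not> can_be_drained P C"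
proof -
  have "(\<Sum>j\<in>UNIV. P $ i $ j) = 1 \<longleftrightarrow> \<not> (\<Sum>j\<in>UNIV. P $ i $ j) < 1"
    and "P $ i $ j = 0 \<longleftrightarrow> \<not> 0 < P $ i $ j" for i j
    using assms by (auto simp: substochastic_def not_less intro: antisym)
  then show ?thesis
    unfolding absorbing_iff[OF assms] can_be_drained_def externally_drained_def
      internally_drained_def by blast
qed

lemma can_be_filled_iff:
  assumes "substochastic P"
  shows "can_be_filled \<alpha> P C \<longleftrightarrow> (\<exists>i. 0 < \<alpha> $ i \<and> (\<exists>j\<in>C. (i, j) \<in> (edges P)\<^sup>*))"
  using ex_matpow_pos_iff[OF assms] unfolding can_be_filled_def by blast

text \<open>
  An isolated class is exactly a class that is absorbing and cannot be filled. Passing from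
  classes to arbitrary absorbing sets removes irreducibility from the remaining arguments,
  which only ever produce absorbing sets.
\<close>
lemma NI_iff_absorbing_filled:
  assumes P: "substochastic P"
  shows "NI \<alpha> P \<longleftrightarrow> (\<forall>D. absorbing P D \<longrightarrow> can_be_filled \<alpha> P D)"
proof
  assume NI: "NI \<alpha> P"
  show "\<forall>D. absorbing P D \<longrightarrow> can_be_filled \<alpha> P D"
  proof (intro allI impI)
    fix D assume "absorbing P D"
    then obtain C where "C \<subseteq> D" "absorbing P C" "C \<in> classes P"
      using absorbing_contains_class[OF P] by blast
    with NI have "can_be_filled \<alpha> P C"
      by (auto simp: NI_def isolated_class_def absorbing_iff_not_drained[OF P])
    then show "can_be_filled \<alpha> P D"
      using \<open>C \<subseteq> D\<close> by (auto simp: can_be_filled_iff[OF P])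
  qed
next
  assume *: "\<forall>D. absorbing P D \<longrightarrow> can_be_filled \<alpha> P D"
  have "C \<noteq> {}" if "C \<in> classes P" for C
    using that by (auto simp: classes_def quotient_def communicate_def)
  with * show "NI \<alpha> P"
    by (auto simp: NI_def isolated_class_def absorbing_iff_not_drained[OF P])
qed

section \<open>The linear equation of the algorithm\<close>

text \<open>
  The departure rates that one iteration assumes: nodes in \<open>S\<close> pass on what they receive,
  the others are saturated. With \<open>\<mu> = 0\<close> it is the linear part, and
  \<open>gm_flow 0 S x v* P = x v* restrict_rows P S\<close>.
\<close>
definition gm_flow :: "real ^ 'n \<Rightarrow> 'n set \<Rightarrow> real ^ 'n \<Rightarrow> real ^ 'n" where
  "gm_flow \<mu> S x = (\<chi> i. if i \<in> S then x $ i else \<mu> $ i)"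

lemma gm_flow_nth [simp]: "gm_flow \<mu> S x $ i = (if i \<in> S then x $ i else \<mu> $ i)"
  by (simp add: gm_flow_def)

lemma gm_equation_iff:
  "gm_equation \<alpha> \<mu> P S x \<longleftrightarrow> x = \<alpha> + gm_flow \<mu> S x v* P"
proof -
  have "(\<mu> v* restrict_rows P (-S) + x v* restrict_rows P S) $ j = (gm_flow \<mu> S x v* P) $ j" for j
    by (simp add: vector_matrix_mult_nth restrict_rows_def flip: sum.distrib)
      (auto intro!: sum.cong)
  then have "\<mu> v* restrict_rows P (-S) + x v* restrict_rows P S = gm_flow \<mu> S x v* P"
    by (simp add: vec_eq_iff)
  then show ?thesis
    by (simp add: gm_equation_def add.assoc)
qed

lemma gm_equation_nth:
  "gm_equation \<alpha> \<mu> P S x \<Longrightarrow> x $ j = \<alpha> $ j + (gm_flow \<mu> S x v* P) $ j"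
  unfolding gm_equation_iff by (drule arg_cong[where f = "\<lambda>v. v $ j"]) simp

text \<open>
  For substochastic \<open>P\<close> this is equivalent to invertibility of \<open>I - P\<^sub>S\<close>, in combinatorial
  terms.
\<close>
definition absorbs_nothing :: "real ^ 'n ^ 'n \<Rightarrow> 'n set \<Rightarrow> bool" where
  "absorbs_nothing P S \<longleftrightarrow> (\<forall>D\<subseteq>S. \<not> absorbing P D)"

text \<open>
  The inverse of \<open>I - P\<^sub>S\<close> preserves nonnegativity: the set \<open>D\<close> where \<open>d\<close> is negative
  can only receive nonnegative amounts from outside, so its deficit would have to sustain
  itself, which makes \<open>D\<close> an absorbing subset of \<open>S\<close>.
\<close>
lemma comparison_principle:
  fixes d :: "real ^ 'n"
  assumes P: "substochastic P" and S: "absorbs_nothing P S"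
    and super: "\<And>j. (gm_flow 0 S d v* P) $ j \<le> d $ j"
  shows "0 \<le> d $ i"
proof (rule ccontr)
  assume "\<not> 0 \<le> d $ i"
  define D where "D = {i. d $ i < 0}"
  define v where "v = gm_flow 0 S d"
  have v: "\<forall>j\<in>D. (v v* P) $ j \<le> d $ j"
    using super v_def by simp
  have outside: "\<forall>i\<in>-D. 0 \<le> v $ i * (\<Sum>j\<in>D. P $ i $ j)"
    using substochastic_row_nonneg[OF P] by (auto simp: D_def v_def)
  have kept: "\<forall>i\<in>D. v $ i \<le> v $ i * (\<Sum>j\<in>D. P $ i $ j)"
    by (intro ballI mult_row_ge_self[OF P]) (auto simp: D_def v_def)
  have inside: "\<forall>i\<in>D. d $ i \<le> v $ i"
    by (auto simp: D_def v_def)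
  note balance = flow_balance[OF v outside kept inside]
  have "i \<in> S \<and> (\<Sum>j\<in>D. P $ i $ j) = 1" if "i \<in> D" for i
    using balance(3,4)[OF that] that by (auto simp: D_def v_def split: if_splits)
  then have "absorbing P D" "D \<subseteq> S"
    using \<open>\<not> 0 \<le> d $ i\<close> by (auto simp: absorbing_def D_def not_le)
  then show False
    using S by (auto simp: absorbs_nothing_def)
qed

lemma gm_flow_diff_mult:
  "(gm_flow \<mu> S x v* P) $ j - (gm_flow \<mu> S y v* P) $ j = (gm_flow 0 S (x - y) v* P) $ j"
proof -
  have "gm_flow \<mu> S x - gm_flow \<mu> S y = gm_flow 0 S (x - y)"
    by (simp add: vec_eq_iff)
  then show ?thesis
    by (simp flip: vector_matrix_mult_diff_distrib vector_minus_component)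
qed

lemma gm_equation_mono:
  assumes P: "substochastic P" and S: "absorbs_nothing P S"
    and y: "gm_equation \<alpha> \<mu> P S y"
    and x: "\<And>j. (\<alpha> + gm_flow \<mu> S x v* P) $ j \<le> x $ j"
  shows "y $ i \<le> x $ i"
proof -
  have "(gm_flow 0 S (x - y) v* P) $ j \<le> (x - y) $ j" for j
    using x[of j] gm_equation_nth[OF y, of j] gm_flow_diff_mult[of \<mu> S x P j y] by simp
  from comparison_principle[OF P S this, of i] show ?thesis by simp
qed

text \<open>
  The comparison principle applied to \<open>x\<close> and \<open>- x\<close> shows that the linear part is
  injective, hence surjective.
\<close>
lemma gm_equation_ex1:
  fixes P :: "real ^ 'n ^ 'n"
  assumes P: "substochastic P" and S: "absorbs_nothing P S"
  shows "\<exists>!x. gm_equation \<alpha> \<mu> P S x"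
proof (rule ex_ex1I)
  define f where "f x = x - gm_flow 0 S x v* P" for x
  have lin: "linear f"
  proof (rule linearI)
    fix x y :: "real ^ 'n" and c :: real
    have "gm_flow 0 S (x + y) = gm_flow 0 S x + gm_flow 0 S y"
      by (simp add: vec_eq_iff)
    then show "f (x + y) = f x + f y"
      by (simp add: f_def vector_matrix_left_distrib)
    have "gm_flow 0 S (c *\<^sub>R x) = c *\<^sub>R gm_flow 0 S x"
      by (simp add: vec_eq_iff)
    then show "f (c *\<^sub>R x) = c *\<^sub>R f x"
      by (simp add: f_def scaleR_vector_matrix_assoc scaleR_right_diff_distrib)
  qed
  have nonneg: "0 \<le> x $ i" if "f x = 0" for x i
    by (rule comparison_principle[OF P S]) (use that in \<open>simp add: f_def\<close>)
  have "x = 0" if "f x = 0" for x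
  proof -
    have "f (- x) = 0"
      using that linear_neg[OF lin, of x] by simp
    then have "x $ i = 0" for i
      using nonneg[OF that, of i] nonneg[of "- x" i] by simp
    then show ?thesis by (simp add: vec_eq_iff)
  qed
  then have "inj f"
    using linear_injective_0[OF lin] by blast
  then have "surj f"
    by (rule linear_inj_imp_surj[OF lin])
  then obtain x where "\<alpha> + gm_flow \<mu> S 0 v* P = f x"
    by (rule surjE)
  then have x: "\<alpha> $ j + (gm_flow \<mu> S 0 v* P) $ j = x $ j - (gm_flow 0 S x v* P) $ j" for j
    unfolding f_def by (drule_tac arg_cong[where f = "\<lambda>v. v $ j"]) simp
  have "x $ j = (\<alpha> + gm_flow \<mu> S x v* P) $ j" for j
    using x[of j] gm_flow_diff_mult[of \<mu> S x P j 0] by simp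
  then have "x = \<alpha> + gm_flow \<mu> S x v* P"
    unfolding vec_eq_iff by blast
  then show "\<exists>x. gm_equation \<alpha> \<mu> P S x"
    using gm_equation_iff by blast
next
  fix x y assume xy: "gm_equation \<alpha> \<mu> P S x" "gm_equation \<alpha> \<mu> P S y"
  have "y $ i \<le> x $ i" if "gm_equation \<alpha> \<mu> P S x" "gm_equation \<alpha> \<mu> P S y" for x y i
    by (rule gm_equation_mono[OF P S that(2)])
      (use gm_equation_nth[OF that(1)] in simp)
  from this[OF xy] this[OF xy(2,1)] show "x = y"
    unfolding vec_eq_iff by (blast intro: antisym)
qed

lemma gm_equation_nonneg:
  assumes net: "network \<alpha> \<mu> P" and S: "absorbs_nothing P S"
    and x: "gm_equation \<alpha> \<mu> P S x"
  shows "0 \<le> x $ i"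
proof -
  have P: "substochastic P" using net by (simp add: network_def)
  have "(gm_flow 0 S x v* P) $ j \<le> x $ j" for j
  proof -
    have "0 \<le> (gm_flow \<mu> S 0 v* P) $ j"
      unfolding vector_matrix_mult_nth using net
      by (intro sum_nonneg) (auto simp: network_def substochastic_def less_imp_le)
    moreover have "0 \<le> \<alpha> $ j"
      using net by (simp add: network_def)
    ultimately show ?thesis
      using gm_equation_nth[OF x, of j] gm_flow_diff_mult[of \<mu> S x P j 0] by simp
  qed
  from comparison_principle[OF P S this] show ?thesis .
qed

section \<open>The algorithm\<close>

text \<open>
  Let \<open>S'\<close> be the next set. In an absorbing \<open>D \<subseteq> S'\<close> the departure rate of a node in
  \<open>S' - S\<close> is \<open>\<mu>\<close>, strictly above \<open>x\<close>; since \<open>D\<close> keeps all that it sends out, mass balance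
  rules such nodes out, and \<open>D \<subseteq> S\<close>. Moreover \<open>x\<close> is a supersolution of the
  equation for \<open>S'\<close>, since lowering the rates on \<open>S' - S\<close> from \<open>\<mu>\<close> to \<open>x\<close> decreases the
  right-hand side.
\<close>
lemma gm_step:
  assumes net: "network \<alpha> \<mu> P" and S: "absorbs_nothing P S"
    and x: "gm_equation \<alpha> \<mu> P S x" and grow: "S \<subseteq> {i. x $ i < \<mu> $ i}"
  shows gm_step_absorbs_nothing: "absorbs_nothing P {i. x $ i < \<mu> $ i}"
    and gm_step_decreasing: "gm_equation \<alpha> \<mu> P {i. x $ i < \<mu> $ i} y \<Longrightarrow> y $ k \<le> x $ k"
proof -
  have P: "substochastic P" using net by (simp add: network_def)
  define v where "v = gm_flow \<mu> S x"
  have xv: "x $ j = \<alpha> $ j + (v v* P) $ j" for j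
    using gm_equation_nth[OF x] by (simp add: v_def)
  have v0: "0 \<le> v $ i" for i
    using gm_equation_nonneg[OF net S x] net by (auto simp: v_def network_def less_imp_le)
  have "\<not> absorbing P D" if D: "D \<subseteq> {i. x $ i < \<mu> $ i}" for D
  proof
    assume abs: "absorbing P D"
    have "i \<in> S" if "i \<in> D" for i
    proof -
      have "v $ i = x $ i"
      proof (rule flow_balance(4)[OF _ _ _ _ that])
        show "\<forall>j\<in>D. (v v* P) $ j \<le> x $ j"
          using xv net by (simp add: network_def)
        show "\<forall>i\<in>-D. 0 \<le> v $ i * (\<Sum>j\<in>D. P $ i $ j)"
          using v0 substochastic_row_nonneg[OF P] by simp
        show "\<forall>i\<in>D. v $ i \<le> v $ i * (\<Sum>j\<in>D. P $ i $ j)"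
          using abs by (simp add: absorbing_def)
        show "\<forall>i\<in>D. x $ i \<le> v $ i"
          using D by (auto simp: v_def less_imp_le)
      qed
      then show "i \<in> S"
        using that D by (auto simp: v_def split: if_splits)
    qed
    then show False
      using S abs by (auto simp: absorbs_nothing_def)
  qed
  then show S': "absorbs_nothing P {i. x $ i < \<mu> $ i}"
    by (simp add: absorbs_nothing_def)
  show "y $ k \<le> x $ k" if "gm_equation \<alpha> \<mu> P {i. x $ i < \<mu> $ i} y"
  proof (rule gm_equation_mono[OF P S' that])
    fix j
    have "gm_flow \<mu> {i. x $ i < \<mu> $ i} x $ i \<le> v $ i" for i
      using grow by (auto simp: v_def)
    then have "(gm_flow \<mu> {i. x $ i < \<mu> $ i} x v* P) $ j \<le> (v v* P) $ j"
      unfolding vector_matrix_mult_nth using P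
      by (intro sum_mono mult_right_mono) (simp_all add: substochastic_def)
    then show "(\<alpha> + gm_flow \<mu> {i. x $ i < \<mu> $ i} x v* P) $ j \<le> x $ j"
      using xv[of j] by simp
  qed
qed

lemma gm_solve_equation:
  assumes "substochastic P" "absorbs_nothing P S"
  shows "gm_equation \<alpha> \<mu> P S (gm_solve \<alpha> \<mu> P S)"
  unfolding gm_solve_def using gm_equation_ex1[OF assms] by (metis someI_ex)

lemma gm_set_invariant:
  assumes net: "network \<alpha> \<mu> P"
  shows "absorbs_nothing P (gm_set \<alpha> \<mu> P \<kappa>) \<and> gm_set \<alpha> \<mu> P \<kappa> \<subseteq> gm_set \<alpha> \<mu> P (Suc \<kappa>)"
proof (induction \<kappa>)
  case 0
  show ?case by (simp add: absorbs_nothing_def absorbing_def)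
next
  case (Suc \<kappa>)
  have P: "substochastic P" using net by (simp add: network_def)
  let ?x = "gm_solve \<alpha> \<mu> P (gm_set \<alpha> \<mu> P \<kappa>)"
  have S: "absorbs_nothing P (gm_set \<alpha> \<mu> P \<kappa>)"
    and grow: "gm_set \<alpha> \<mu> P \<kappa> \<subseteq> {i. ?x $ i < \<mu> $ i}"
    using Suc by simp_all
  note x = gm_solve_equation[OF P S, of \<alpha> \<mu>]
  have S': "absorbs_nothing P (gm_set \<alpha> \<mu> P (Suc \<kappa>))"
    using gm_step_absorbs_nothing[OF net S x grow] by simp
  have "gm_solve \<alpha> \<mu> P (gm_set \<alpha> \<mu> P (Suc \<kappa>)) $ i \<le> ?x $ i" for i
    using gm_step_decreasing[OF net S x grow] gm_solve_equation[OF P S', of \<alpha> \<mu>] by simp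
  then have "gm_set \<alpha> \<mu> P (Suc \<kappa>) \<subseteq> gm_set \<alpha> \<mu> P (Suc (Suc \<kappa>))"
    by (auto intro: le_less_trans)
  with S' show ?case by blast
qed

text \<open>
  Before the stop each iteration adds a node. The iteration that detects the stop adds none,
  whence the \<open>+ 1\<close>.
\<close>
lemma gm_terminates:
  fixes \<alpha> \<mu> :: "real ^ 'n"
  assumes net: "network \<alpha> \<mu> P"
  obtains \<kappa> where "gm_stops_at \<alpha> \<mu> P \<kappa>" "\<kappa> \<le> card (gm_set \<alpha> \<mu> P \<kappa>) + 1"
proof -
  let ?S = "gm_set \<alpha> \<mu> P"
  have grow: "?S k \<subseteq> ?S (Suc k)" for k
    using gm_set_invariant[OF net] by blast
  have strict: "k \<le> card (?S k)" if "\<forall>l<k. ?S (Suc l) \<noteq> ?S l" for k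
    using that
  proof (induction k)
    case (Suc k)
    then have "k \<le> card (?S k)" "?S k \<subset> ?S (Suc k)"
      using grow[of k] by (simp, blast)
    then have "k < card (?S (Suc k))"
      using psubset_card_mono[of "?S (Suc k)" "?S k"] by simp
    then show ?case by simp
  qed simp
  have ex: "\<exists>k. ?S (Suc k) = ?S k"
  proof (rule ccontr)
    assume "\<nexists>k. ?S (Suc k) = ?S k"
    then have "Suc CARD('n) \<le> card (?S (Suc CARD('n)))"
      using strict by blast
    moreover have "card (?S (Suc CARD('n))) \<le> CARD('n)"
      by (intro card_mono) auto
    ultimately show False by simp
  qed
  define k where "k = (LEAST k. ?S (Suc k) = ?S k)"
  have eq: "?S (Suc k) = ?S k"
    unfolding k_def using ex by (rule LeastI_ex)
  have before: "?S (Suc l) \<noteq> ?S l" if "l < k" for l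
    using that not_less_Least k_def by blast
  have "?S \<kappa>' \<noteq> ?S (\<kappa>' - 1)" if "\<kappa>' \<in> {1..<Suc k}" for \<kappa>'
    using before that by (cases \<kappa>') (auto simp del: gm_set.simps)
  with eq have "gm_stops_at \<alpha> \<mu> P (Suc k)"
    by (simp add: gm_stops_at_def del: gm_set.simps)
  moreover have "Suc k \<le> card (?S (Suc k)) + 1"
    using strict before eq by (metis Suc_eq_plus1 Suc_le_mono)
  ultimately show thesis by (rule that)
qed

lemma gm_fixed_point_solves_traffic:
  assumes x: "gm_equation \<alpha> \<mu> P {i. x $ i < \<mu> $ i} x"
  shows "traffic_solution \<alpha> \<mu> P x"
proof -
  have "gm_flow \<mu> {i. x $ i < \<mu> $ i} x = vmin x \<mu>"
    by (simp add: vec_eq_iff vmin_def min_def less_le)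
  then show ?thesis
    using x by (simp add: gm_equation_iff traffic_solution_def)
qed

lemma gm_stops_at_solution:
  assumes net: "network \<alpha> \<mu> P" and stop: "gm_stops_at \<alpha> \<mu> P \<kappa>"
  shows "traffic_solution \<alpha> \<mu> P (gm_lambda \<alpha> \<mu> P \<kappa>)" and "0 \<le> gm_lambda \<alpha> \<mu> P \<kappa> $ i"
proof -
  have P: "substochastic P" using net by (simp add: network_def)
  obtain k where k: "\<kappa> = Suc k"
    using stop by (cases \<kappa>) (auto simp: gm_stops_at_def)
  let ?x = "gm_lambda \<alpha> \<mu> P \<kappa>"
  have S: "absorbs_nothing P (gm_set \<alpha> \<mu> P k)"
    using gm_set_invariant[OF net] by blast
  have x: "gm_equation \<alpha> \<mu> P (gm_set \<alpha> \<mu> P k) ?x"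
    using gm_solve_equation[OF P S] by (simp add: gm_lambda_def k)
  have "gm_set \<alpha> \<mu> P k = {i. ?x $ i < \<mu> $ i}"
    using stop by (simp add: gm_stops_at_def gm_lambda_def k)
  with x show "traffic_solution \<alpha> \<mu> P ?x"
    using gm_fixed_point_solves_traffic[of \<alpha> \<mu> P ?x] by simp
  show "0 \<le> ?x $ i"
    using gm_equation_nonneg[OF net S x] .
qed

section \<open>Uniqueness under NI\<close>

lemma traffic_solution_nth:
  "traffic_solution \<alpha> \<mu> P x \<Longrightarrow> x $ j = \<alpha> $ j + (vmin x \<mu> v* P) $ j"
  unfolding traffic_solution_def by (drule arg_cong[where f = "\<lambda>v. v $ j"]) simp

text \<open>
  Where \<open>x \<le> \<mu>\<close>, nodes send on all that they receive. If in addition nothing leaves \<open>D\<close>,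
  any mass entering \<open>D\<close> would accumulate, so none enters.
\<close>
lemma absorbing_no_inflow:
  assumes net: "network \<alpha> \<mu> P" and D: "absorbing P D"
    and x: "traffic_solution \<alpha> \<mu> P x" and x0: "\<And>i. 0 \<le> x $ i"
    and le: "\<forall>i\<in>D. x $ i \<le> \<mu> $ i"
  shows "i \<in> D \<Longrightarrow> \<alpha> $ i = 0"
    and "i \<notin> D \<Longrightarrow> j \<in> D \<Longrightarrow> 0 < P $ i $ j \<Longrightarrow> x $ i = 0"
proof -
  have P: "substochastic P" using net by (simp add: network_def)
  let ?v = "vmin x \<mu>"
  have v0: "0 \<le> ?v $ i" for i
    using x0 net by (simp add: vmin_def network_def less_imp_le)
  have v: "\<forall>j\<in>D. (?v v* P) $ j \<le> x $ j"
    using traffic_solution_nth[OF x] net by (simp add: network_def)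
  have outside: "\<forall>i\<in>-D. 0 \<le> ?v $ i * (\<Sum>j\<in>D. P $ i $ j)"
    using v0 substochastic_row_nonneg[OF P] by simp
  have kept: "\<forall>i\<in>D. ?v $ i \<le> ?v $ i * (\<Sum>j\<in>D. P $ i $ j)"
    using D by (simp add: absorbing_def)
  have inside: "\<forall>i\<in>D. x $ i \<le> ?v $ i"
    using le by (simp add: vmin_def)
  note balance = flow_balance[OF v outside kept inside]
  show "\<alpha> $ i = 0" if "i \<in> D"
    using balance(1)[OF that] traffic_solution_nth[OF x, of i] by simp
  show "x $ i = 0" if "i \<notin> D" "j \<in> D" "0 < P $ i $ j"
  proof -
    have "P $ i $ j \<le> (\<Sum>j\<in>D. P $ i $ j)"
      using that P by (intro member_le_sum) (auto simp: substochastic_def)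
    then have "?v $ i = 0"
      using balance(2)[OF that(1)] that(3) by auto
    moreover have "0 < \<mu> $ i" using net by (simp add: network_def)
    ultimately show ?thesis by (simp add: vmin_def min_def split: if_splits)
  qed
qed

lemma traffic_solution_zero_backward:
  assumes net: "network \<alpha> \<mu> P"
    and x: "traffic_solution \<alpha> \<mu> P x" and x0: "\<And>i. 0 \<le> x $ i" and j: "x $ j = 0"
  shows "\<alpha> $ j = 0" and "0 < P $ i $ j \<Longrightarrow> x $ i = 0"
proof -
  have pos: "0 < \<mu> $ i" for i using net by (simp add: network_def)
  have nonneg: "0 \<le> vmin x \<mu> $ i * P $ i $ j" for i
    using x0 pos net by (simp add: vmin_def network_def substochastic_def less_imp_le)
  have "0 \<le> \<alpha> $ j" "0 \<le> (vmin x \<mu> v* P) $ j"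
    using net nonneg by (auto simp: network_def vector_matrix_mult_nth intro: sum_nonneg)
  then have "\<alpha> $ j = 0" and 0: "(vmin x \<mu> v* P) $ j = 0"
    using traffic_solution_nth[OF x, of j] j by linarith+
  then show "\<alpha> $ j = 0" by simp
  have "vmin x \<mu> $ i * P $ i $ j = 0"
    using 0 nonneg unfolding vector_matrix_mult_nth
    by (subst (asm) sum_nonneg_eq_0_iff) auto
  then show "x $ i = 0" if "0 < P $ i $ j"
    using that pos[of i] by (auto simp: vmin_def min_def split: if_splits)
qed

text \<open>
  The nodes that feed \<open>D\<close> have \<open>x = 0\<close>, hence so do those that feed them, and so on.
  Thus \<open>D\<close> together with the zeros of \<open>x\<close> is closed under predecessors, and \<open>\<alpha>\<close> vanishes on
  this union.
\<close>
lemma absorbing_le_not_filled: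
  assumes net: "network \<alpha> \<mu> P" and D: "absorbing P D"
    and x: "traffic_solution \<alpha> \<mu> P x" and x0: "\<And>i. 0 \<le> x $ i"
    and le: "\<forall>i\<in>D. x $ i \<le> \<mu> $ i"
  shows "\<not> can_be_filled \<alpha> P D"
proof -
  have P: "substochastic P" using net by (simp add: network_def)
  let ?U = "D \<union> {i. x $ i = 0}"
  note inflow = absorbing_no_inflow[OF net D x x0 le]
  note zero = traffic_solution_zero_backward[OF net x x0]
  have "i \<in> ?U" if "(i, j) \<in> (edges P)\<^sup>*" "j \<in> D" for i j
    using that
  proof (induction rule: converse_rtrancl_induct)
    case (step i k)
    then have "0 < P $ i $ k" "k \<in> ?U" by (auto simp: edges_def)
    then show ?case using inflow(2) zero(2) by blast
  qed simp
  moreover have "\<alpha> $ i = 0" if "i \<in> ?U" for i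
    using that inflow(1) zero(1) by blast
  ultimately show ?thesis
    unfolding can_be_filled_iff[OF P] by (metis less_irrefl)
qed

text \<open>
  The map \<open>t \<mapsto> min t \<mu>\<close> is monotone and does not increase distances, so an excess of
  \<open>x\<close> over \<open>y\<close> can only be sustained by an absorbing set on which it is passed on
  undiminished; the latter means that \<open>x \<le> \<mu>\<close> there. Nonnegativity of one solution is enough,
  because the bound \<open>\<mu>\<close> on that set is inherited by \<open>y\<close>.
\<close>
lemma traffic_solution_le_if_NI:
  assumes net: "network \<alpha> \<mu> P" and NI: "NI \<alpha> P"
    and x: "traffic_solution \<alpha> \<mu> P x" and y: "traffic_solution \<alpha> \<mu> P y"
    and nonneg: "(\<forall>i. 0 \<le> x $ i) \<or> (\<forall>i. 0 \<le> y $ i)"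
  shows "x $ i \<le> y $ i"
proof (rule ccontr)
  assume i: "\<not> x $ i \<le> y $ i"
  have P: "substochastic P" using net by (simp add: network_def)
  define D where "D = {i. y $ i < x $ i}"
  \<comment> \<open>In this order of subtraction \<open>v \<le> 0\<close> on \<open>D\<close>, as the mass balance needs.\<close>
  define d v where "d = y - x" and "v = vmin y \<mu> - vmin x \<mu>"
  have d: "\<forall>j\<in>D. (v v* P) $ j \<le> d $ j"
    using traffic_solution_nth[OF x] traffic_solution_nth[OF y]
    by (simp add: d_def v_def vector_matrix_mult_diff_distrib)
  have outside: "\<forall>i\<in>-D. 0 \<le> v $ i * (\<Sum>j\<in>D. P $ i $ j)"
    using substochastic_row_nonneg[OF P] by (auto simp: D_def v_def vmin_def)
  have kept: "\<forall>i\<in>D. v $ i \<le> v $ i * (\<Sum>j\<in>D. P $ i $ j)"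
    by (intro ballI mult_row_ge_self[OF P]) (auto simp: D_def v_def vmin_def)
  have inside: "\<forall>i\<in>D. d $ i \<le> v $ i"
    by (auto simp: D_def d_def v_def vmin_def)
  note balance = flow_balance[OF d outside kept inside]
  have "(\<Sum>j\<in>D. P $ i $ j) = 1 \<and> x $ i \<le> \<mu> $ i" if "i \<in> D" for i
    using balance(3,4)[OF that] that
    by (auto simp: D_def d_def v_def vmin_def min_def split: if_splits)
  then have D: "absorbing P D" and xle: "\<forall>i\<in>D. x $ i \<le> \<mu> $ i"
    using i by (auto simp: absorbing_def D_def not_le)
  then have yle: "\<forall>i\<in>D. y $ i \<le> \<mu> $ i"
    by (force simp: D_def)
  have "\<not> can_be_filled \<alpha> P D"
    using nonneg absorbing_le_not_filled[OF net D x _ xle]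
      absorbing_le_not_filled[OF net D y _ yle] by blast
  moreover have "can_be_filled \<alpha> P D"
    using NI D NI_iff_absorbing_filled[OF P] by blast
  ultimately show False by blast
qed

section \<open>Non-uniqueness without NI\<close>

text \<open>
  The set \<open>U\<close> of nodes from which \<open>D\<close> can be reached receives nothing from outside and has
  \<open>\<alpha> = 0\<close>, so its only supply is its own output \<open>min x \<mu>\<close>; any loss at a node with
  \<open>x > \<mu>\<close> could not be made up. This is \<open>flow_balance\<close> with reversed signs.
\<close>
lemma unfilled_traffic_solution_le:
  assumes net: "network \<alpha> \<mu> P" and D: "\<not> can_be_filled \<alpha> P D"
    and x: "traffic_solution \<alpha> \<mu> P x" and x0: "\<And>i. 0 \<le> x $ i"
  shows "\<forall>i\<in>D. x $ i \<le> \<mu> $ i"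
proof
  fix i assume i: "i \<in> D"
  have P: "substochastic P" using net by (simp add: network_def)
  define U where "U = {i. \<exists>j\<in>D. (i, j) \<in> (edges P)\<^sup>*}"
  have \<alpha>: "\<alpha> $ i = 0" if "i \<in> U" for i
  proof -
    have "\<not> 0 < \<alpha> $ i"
      using that D unfolding U_def can_be_filled_iff[OF P] by blast
    moreover have "0 \<le> \<alpha> $ i" using net by (simp add: network_def)
    ultimately show ?thesis by simp
  qed
  have pred: "P $ i $ j = 0" if "i \<notin> U" "j \<in> U" for i j
  proof -
    have "(i, j) \<notin> edges P"
      using that by (auto simp: U_def intro: converse_rtrancl_into_rtrancl)
    then show ?thesis
      using P by (auto simp: edges_def substochastic_def intro: antisym)
  qed
  have v0: "0 \<le> vmin x \<mu> $ i" for i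
    using x0 net by (simp add: vmin_def network_def less_imp_le)
  have "(- vmin x \<mu>) $ i = (- x) $ i"
  proof (rule flow_balance(4)[where D = U and P = P])
    show "\<forall>j\<in>U. (- vmin x \<mu> v* P) $ j \<le> (- x) $ j"
      using traffic_solution_nth[OF x] \<alpha>
      by (simp add: vector_matrix_mult_nth sum_negf)
    show "\<forall>i\<in>-U. 0 \<le> (- vmin x \<mu>) $ i * (\<Sum>j\<in>U. P $ i $ j)"
      using pred by simp
    show "\<forall>i\<in>U. (- vmin x \<mu>) $ i \<le> (- vmin x \<mu>) $ i * (\<Sum>j\<in>U. P $ i $ j)"
      by (intro ballI mult_row_ge_self[OF P]) (simp add: v0)
    show "\<forall>i\<in>U. (- x) $ i \<le> (- vmin x \<mu>) $ i"
      by (simp add: vmin_def)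
    show "i \<in> U"
      using i by (auto simp: U_def)
  qed
  then show "x $ i \<le> \<mu> $ i" by (simp add: vmin_def min_def split: if_splits)
qed

text \<open>
  The indicator of \<open>D\<close> is a column vector fixed by \<open>P\<^sub>D\<close>, so \<open>I - P\<^sub>D\<close> is singular and has a
  row vector in its kernel. The entries of \<open>d\<close> may have any sign.
\<close>
lemma absorbing_invariant_vector:
  fixes P :: "real ^ 'n ^ 'n"
  assumes P: "substochastic P" and D: "absorbing P D"
  obtains d :: "real ^ 'n" where "d \<noteq> 0" "d v* P = d" "\<And>i. i \<notin> D \<Longrightarrow> d $ i = 0"
proof -
  let ?A = "mat 1 - restrict_rows P D"
  let ?e = "(\<chi> i. if i \<in> D then 1 else 0) :: real ^ 'n"
  have "(restrict_rows P D *v ?e) $ i = ?e $ i" for i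
  proof -
    have "(restrict_rows P D *v ?e) $ i = (if i \<in> D then \<Sum>j\<in>D. P $ i $ j else 0)"
      by (auto simp: matrix_vector_mult_def restrict_rows_def if_distrib sum.If_cases
          cong: if_cong)
    then show ?thesis using D by (simp add: absorbing_def)
  qed
  then have "?A *v ?e = 0"
    by (simp add: vec_eq_iff matrix_vector_mult_diff_rdistrib)
  moreover have "?e \<noteq> 0"
    using D by (auto simp: vec_eq_iff absorbing_def)
  ultimately have "\<not> invertible ?A"
    by (meson invertible_def matrix_left_invertible_ker)
  then have "\<not> invertible (transpose ?A)"
    by (metis transpose_transpose transpose_invertible)
  then obtain d where d: "d \<noteq> 0" "transpose ?A *v d = 0"
    by (meson invertible_left_inverse matrix_left_invertible_ker)
  then have "d = d v* restrict_rows P D"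
    by (simp add: vector_matrix_mult_diff_rdistrib)
  then have "d $ j = (d v* restrict_rows P D) $ j" for j
    by metis
  also have "(d v* restrict_rows P D) $ j = (\<Sum>i\<in>D. d $ i * P $ i $ j)" for j
    unfolding vector_matrix_mult_nth
    by (rule sum.mono_neutral_cong_right) (auto simp: restrict_rows_def)
  finally have d_eq: "d $ j = (\<Sum>i\<in>D. d $ i * P $ i $ j)" for j .
  have d0: "d $ j = 0" if "j \<notin> D" for j
    using D that by (subst d_eq) (auto simp: absorbing_iff[OF P] intro!: sum.neutral)
  have "(d v* P) $ j = d $ j" for j
    unfolding vector_matrix_mult_nth
    by (subst d_eq[of j]) (rule sum.mono_neutral_right; simp add: d0)
  then have "d v* P = d" by (simp add: vec_eq_iff)
  with d(1) d0 that show thesis by blast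
qed

text \<open>
  By \<open>absorbing_no_inflow\<close>, resetting \<open>x\<close> to zero on \<open>D\<close> yields a solution \<open>y\<close>. Around \<open>y\<close>
  the equation is linear in direction \<open>d\<close> as long as \<open>\<mu>\<close> is not exceeded on \<open>D\<close>.
\<close>
lemma traffic_solution_not_unique:
  assumes net: "network \<alpha> \<mu> P" and D: "absorbing P D" "\<not> can_be_filled \<alpha> P D"
    and x: "traffic_solution \<alpha> \<mu> P x" and x0: "\<And>i. 0 \<le> x $ i"
  obtains y z where "traffic_solution \<alpha> \<mu> P y" "traffic_solution \<alpha> \<mu> P z" "y \<noteq> z"
proof -
  have P: "substochastic P" using net by (simp add: network_def)
  have pos: "0 < \<mu> $ i" for i using net by (simp add: network_def)
  obtain d where d: "d \<noteq> 0" "d v* P = d" and d0: "\<And>i. i \<notin> D \<Longrightarrow> d $ i = 0"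
    using absorbing_invariant_vector[OF P D(1)] by blast
  \<comment> \<open>Small enough for \<open>\<epsilon> * d \<le> \<mu>\<close>; the \<open>+ 1\<close> avoids division by zero.\<close>
  define \<epsilon> where "\<epsilon> = Min (range (\<lambda>i. \<mu> $ i / (\<bar>d $ i\<bar> + 1)))"
  have "0 < \<epsilon>"
    unfolding \<epsilon>_def by (subst Min_gr_iff) (auto simp: pos intro!: divide_pos_pos)
  have le: "\<epsilon> * d $ i \<le> \<mu> $ i" for i
  proof -
    have "\<epsilon> \<le> \<mu> $ i / (\<bar>d $ i\<bar> + 1)"
      unfolding \<epsilon>_def by (intro Min_le) auto
    then have "\<epsilon> * (\<bar>d $ i\<bar> + 1) \<le> \<mu> $ i"
      by (simp add: pos_le_divide_eq)
    moreover have "\<epsilon> * d $ i \<le> \<epsilon> * (\<bar>d $ i\<bar> + 1)"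
      using \<open>0 < \<epsilon>\<close> by (intro mult_left_mono) auto
    ultimately show ?thesis by linarith
  qed
  note inflow = absorbing_no_inflow[OF net D(1) x x0 unfilled_traffic_solution_le[OF net D(2) x x0]]
  define y where "y = (\<chi> i. if i \<in> D then 0 else x $ i)"
  have y: "y $ j = \<alpha> $ j + (vmin y \<mu> v* P) $ j" for j
  proof (cases "j \<in> D")
    case True
    have "vmin y \<mu> $ i * P $ i $ j = 0" for i
    proof (cases "i \<in> D \<or> P $ i $ j = 0")
      case False
      then have "0 < P $ i $ j" using P by (simp add: substochastic_def less_le)
      then show ?thesis
        using inflow(2)[OF _ True] False pos[of i] by (simp add: y_def vmin_def)
    qed (use pos[of i] in \<open>auto simp: y_def vmin_def\<close>)
    then have "(vmin y \<mu> v* P) $ j = 0"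
      unfolding vector_matrix_mult_nth by (intro sum.neutral) blast
    then show ?thesis
      using inflow(1)[OF True] True by (simp add: y_def)
  next
    case False
    have "vmin y \<mu> $ i * P $ i $ j = vmin x \<mu> $ i * P $ i $ j" for i
      using D(1) False by (auto simp: absorbing_iff[OF P] y_def vmin_def)
    then have "(vmin y \<mu> v* P) $ j = (vmin x \<mu> v* P) $ j"
      by (simp only: vector_matrix_mult_nth)
    then show ?thesis
      using traffic_solution_nth[OF x, of j] False by (simp add: y_def)
  qed
  define z where "z = y + \<epsilon> *\<^sub>R d"
  have vz: "vmin z \<mu> $ i = vmin y \<mu> $ i + \<epsilon> * d $ i" for i
    using le[of i] d0[of i] pos[of i] by (auto simp: z_def vmin_def y_def)
  have "(vmin z \<mu> v* P) $ j = (vmin y \<mu> v* P) $ j + \<epsilon> * (d v* P) $ j" for j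
    unfolding vector_matrix_mult_nth vz sum_distrib_left sum.distrib[symmetric]
    by (intro sum.cong) (auto simp: algebra_simps)
  then have "z $ j = \<alpha> $ j + (vmin z \<mu> v* P) $ j" for j
    using y[of j] by (simp add: z_def d(2))
  then have "traffic_solution \<alpha> \<mu> P y" "traffic_solution \<alpha> \<mu> P z"
    using y by (auto simp: traffic_solution_def vec_eq_iff)
  moreover have "y \<noteq> z"
    using d(1) \<open>0 < \<epsilon>\<close> by (simp add: z_def)
  ultimately show thesis using that by blast
qed

section \<open>Characterization of networks without isolated classes\<close>

theorem theorem1:
  fixes \<alpha> \<mu> :: "real ^ 'n" and P :: "real ^ 'n ^ 'n"
  assumes "network \<alpha> \<mu> P"
  shows "(NI \<alpha> P \<longleftrightarrow>
           (\<exists>x. traffic_solution \<alpha> \<mu> P x \<and> (\<forall>i. 0 \<le> x $ i) \<and>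
                (\<forall>y. traffic_solution \<alpha> \<mu> P y \<longrightarrow> y = x))) \<and>
         (NI \<alpha> P \<longrightarrow>
           (\<exists>\<kappa>. gm_stops_at \<alpha> \<mu> P \<kappa> \<and>
                \<kappa> \<le> (if gm_set \<alpha> \<mu> P \<kappa> = UNIV then CARD('n) + 1 else CARD('n)) \<and>
                traffic_solution \<alpha> \<mu> P (gm_lambda \<alpha> \<mu> P \<kappa>) \<and>
                (\<forall>\<kappa>'\<in>{1..\<kappa>}. \<exists>!x. gm_equation \<alpha> \<mu> P (gm_set \<alpha> \<mu> P (\<kappa>' - 1)) x)))"
proof (intro conjI impI iffI)
  have P: "substochastic P" using assms by (simp add: network_def)
  obtain \<kappa> where stop: "gm_stops_at \<alpha> \<mu> P \<kappa>" and \<kappa>: "\<kappa> \<le> card (gm_set \<alpha> \<mu> P \<kappa>) + 1"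
    using gm_terminates[OF assms] .
  let ?x = "gm_lambda \<alpha> \<mu> P \<kappa>"
  note sol = gm_stops_at_solution[OF assms stop]
  show "\<exists>x. traffic_solution \<alpha> \<mu> P x \<and> (\<forall>i. 0 \<le> x $ i) \<and>
      (\<forall>y. traffic_solution \<alpha> \<mu> P y \<longrightarrow> y = x)" if NI: "NI \<alpha> P"
  proof (intro exI conjI allI impI)
    fix y assume y: "traffic_solution \<alpha> \<mu> P y"
    show "y = ?x"
      using traffic_solution_le_if_NI[OF assms NI y sol(1)]
        traffic_solution_le_if_NI[OF assms NI sol(1) y] sol(2)
      by (auto simp: vec_eq_iff intro: antisym)
  qed (use sol in auto)
  show "NI \<alpha> P" if unique: "\<exists>x. traffic_solution \<alpha> \<mu> P x \<and> (\<forall>i. 0 \<le> x $ i) \<and>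
      (\<forall>y. traffic_solution \<alpha> \<mu> P y \<longrightarrow> y = x)"
  proof (rule ccontr)
    assume "\<not> NI \<alpha> P"
    then obtain D where "absorbing P D" "\<not> can_be_filled \<alpha> P D"
      using NI_iff_absorbing_filled[OF P] by blast
    from traffic_solution_not_unique[OF assms this sol] unique show False by metis
  qed
  show "\<exists>\<kappa>. gm_stops_at \<alpha> \<mu> P \<kappa> \<and>
      \<kappa> \<le> (if gm_set \<alpha> \<mu> P \<kappa> = UNIV then CARD('n) + 1 else CARD('n)) \<and>
      traffic_solution \<alpha> \<mu> P (gm_lambda \<alpha> \<mu> P \<kappa>) \<and>
      (\<forall>\<kappa>'\<in>{1..\<kappa>}. \<exists>!x. gm_equation \<alpha> \<mu> P (gm_set \<alpha> \<mu> P (\<kappa>' - 1)) x)"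
  proof (intro exI conjI ballI)
    show "\<kappa> \<le> (if gm_set \<alpha> \<mu> P \<kappa> = UNIV then CARD('n) + 1 else CARD('n))"
    proof (cases "gm_set \<alpha> \<mu> P \<kappa> = UNIV")
      case False
      then have "card (gm_set \<alpha> \<mu> P \<kappa>) < CARD('n)"
        by (intro psubset_card_mono) auto
      with False \<kappa> show ?thesis by simp
    qed (use \<kappa> in simp)
    show "\<exists>!x. gm_equation \<alpha> \<mu> P (gm_set \<alpha> \<mu> P (\<kappa>' - 1)) x" for \<kappa>'
      using gm_equation_ex1[OF P] gm_set_invariant[OF assms] by blast
  qed (fact stop sol(1))+
qed

end
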